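(* Assume (H1) and (H2), and suppose that the limit $$b=\lim_{z\to\infty}q'(z)\int_z^\infty\frac{dx}{q(x)}$$ exists in $\mathbb R$. Then $b\ge0$, $$\lim_{z\to\infty}\frac{q'(z)}{q(z)}\sqrt{\int_z^\infty\frac{dx}{q(x)}}=0,$$ and $$\lim_{z\to\infty}\frac{\int_z^\infty q(x)^{-1}dx}{q(z)^2\int_z^\infty q(x)^{-3}dx}=2b+1.$$
   Context: Let $q\in C^1([0,\infty))$ and $\gamma(y)=2\int_0^yq$. (H1): $\int_0^\infty e^{\gamma(y)}\int_y^\infty e^{-\gamma(\xi)}d\xi\,dy<\infty$. (H2): $\lim_{x\to\infty}q(x)=\infty$ and $\lim_{x\to\infty}q'(x)/q(x)^2=0$. (Under (H1),(H2), $\int_z^\infty q^{-1}<\infty$ for large $z$.) *)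

theory Defs
  imports "HOL-Analysis.Analysis"
begin

definition gam :: "(real \<Rightarrow> real) \<Rightarrow> real \<Rightarrow> real" where
  "gam q y = 2 * integral {0..y} q"

definition tail_int :: "(real \<Rightarrow> real) \<Rightarrow> real \<Rightarrow> real" where
  "tail_int f z = (LINT x:{z..}|lborel. f x)"

end

theory Submission
  imports Defs
begin

text \<open>
  Once q \<ge> 1 and q'/q^2 \<le> e, the function 1/q(x) + e x is nondecreasing, so q at most doubles
  on each window [y, y + 1/(2 e q(y))]. Integrating over such a window bounds \<integral>_z^\<infinity> q^-n from
  below by a multiple of 1/(e q(z)^(n+1)); as e may be taken arbitrarily small,
  q(z)^2 \<integral>_z^\<infinity> 1/q tends to \<infinity>. The same estimate bounds the inner integral of (H1) from
  below by a multiple of exp(-\<gamma>(y))/q(y), so (H1) makes \<integral>^\<infinity> 1/q finite.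

  Then b \<ge> 0, because q' < 0 eventually would contradict q \<rightarrow> \<infinity>; the second limit is
  q' \<integral>_z^\<infinity> 1/q divided by sqrt(q^2 \<integral>_z^\<infinity> 1/q) \<rightarrow> \<infinity>; and the third is l'Hopital's rule
  for (\<integral>_z^\<infinity> 1/q)/q^2 over \<integral>_z^\<infinity> q^-3, whose quotient of derivatives is
  1 + 2 q' \<integral>_z^\<infinity> 1/q.
\<close>

lemma lhopital_at_top_0:
  fixes f g f' g' :: "real \<Rightarrow> real"
  assumes f0: "(f \<longlongrightarrow> 0) at_top" and g0: "(g \<longlongrightarrow> 0) at_top"
    and gnz: "eventually (\<lambda>x. g x \<noteq> 0) at_top"
    and g'nz: "eventually (\<lambda>x. g' x \<noteq> 0) at_top"
    and Df: "eventually (\<lambda>x. DERIV f x :> f' x) at_top"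
    and Dg: "eventually (\<lambda>x. DERIV g x :> g' x) at_top"
    and lim: "((\<lambda> x. (f' x / g' x)) \<longlongrightarrow> y) at_top"
  shows "((\<lambda> x. f x / g x) \<longlongrightarrow> y) at_top"
  unfolding filterlim_at_top_to_right
proof (rule lhopital_right_0)
  let ?F = "\<lambda>x. f (inverse x)"
  let ?G = "\<lambda>x. g (inverse x)"
  let ?R = "at_right (0::real)"
  let ?D = "\<lambda>f' x. f' (inverse x) * - (inverse x ^ Suc (Suc 0))"
  show "(?F \<longlongrightarrow> 0) ?R" using f0 unfolding filterlim_at_top_to_right .
  show "(?G \<longlongrightarrow> 0) ?R" using g0 unfolding filterlim_at_top_to_right .
  show "eventually (\<lambda>x. ?G x \<noteq> 0) ?R"
    unfolding eventually_at_right_to_top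
    using gnz eventually_gt_at_top[where c=0] by eventually_elim simp
  show "eventually (\<lambda>x. DERIV ?G x :> ?D g' x) ?R"
    unfolding eventually_at_right_to_top
    using Dg eventually_ge_at_top[where c=1]
    by eventually_elim (rule derivative_eq_intros DERIV_chain'[where f=inverse] | simp)+
  show "eventually (\<lambda>x. DERIV ?F x :> ?D f' x) ?R"
    unfolding eventually_at_right_to_top
    using Df eventually_ge_at_top[where c=1]
    by eventually_elim (rule derivative_eq_intros DERIV_chain'[where f=inverse] | simp)+
  show "eventually (\<lambda>x. ?D g' x \<noteq> 0) ?R"
    unfolding eventually_at_right_to_top
    using g'nz eventually_ge_at_top[where c=1]
    by eventually_elim auto
  show "((\<lambda>x. ?D f' x / ?D g' x) \<longlongrightarrow> y) ?R"
    unfolding filterlim_at_right_to_top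
    apply (intro filterlim_cong[THEN iffD2, OF refl refl _ lim])
    using eventually_ge_at_top[where c=1]
    by eventually_elim simp
qed

lemma set_integrable_of_nn_integral_finite:
  fixes f :: "real \<Rightarrow> real"
  assumes A: "A \<in> sets borel" and cont: "continuous_on A f"
    and nonneg: "\<And>x. x \<in> A \<Longrightarrow> 0 \<le> f x"
    and fin: "(\<integral>\<^sup>+ x\<in>A. ennreal (f x) \<partial>lborel) < \<infinity>"
  shows "set_integrable lborel A f"
proof -
  have "(\<lambda>x. indicator A x *\<^sub>R f x) \<in> borel_measurable lborel"
    using borel_measurable_continuous_on_indicator[OF A cont] by simp
  moreover have "(\<integral>\<^sup>+ x. ennreal (indicator A x *\<^sub>R f x) \<partial>lborel) = (\<integral>\<^sup>+ x\<in>A. ennreal (f x) \<partial>lborel)"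
    by (intro nn_integral_cong) (auto split: split_indicator)
  ultimately show ?thesis
    unfolding set_integrable_def using fin nonneg
    by (intro integrableI_nonneg) (auto simp: indicator_def)
qed

lemma tail_int_eq_integral:
  assumes "set_integrable lborel {a..} f" and "a \<le> z"
  shows "f integrable_on {z..}" and "tail_int f z = integral {z..} f"
proof -
  have "set_integrable lborel {z..} f"
    by (rule set_integrable_subset[OF assms(1)]) (use assms(2) in auto)
  from set_borel_integral_eq_integral[OF this]
  show "f integrable_on {z..}" and "tail_int f z = integral {z..} f"
    unfolding tail_int_def by simp_all
qed

lemma tail_int_eq_diff:
  assumes cont: "continuous_on {a..} f" and int: "set_integrable lborel {a..} f" and z: "a \<le> z"
  shows "tail_int f z = tail_int f a - integral {a..z} f"
proof -
  have "(f has_integral integral {a..z} f) {a..z}"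
    using continuous_on_subset[OF cont] by (intro integrable_integral integrable_continuous_interval) auto
  moreover have "(f has_integral integral {z..} f) {z..}"
    using tail_int_eq_integral(1)[OF int z] by (simp add: integrable_integral)
  ultimately have "(f has_integral integral {a..z} f + integral {z..} f) ({a..z} \<union> {z..})"
    using z by (intro has_integral_Un) auto
  moreover have "{a..z} \<union> {z..} = {a..}" using z by auto
  ultimately have "integral {a..} f = integral {a..z} f + integral {z..} f"
    by (simp add: integral_unique)
  thus ?thesis using tail_int_eq_integral(2)[OF int] z by simp
qed

lemma tendsto_tail_int_at_top:
  assumes cont: "continuous_on {a..} f" and int: "set_integrable lborel {a..} f"
  shows "(tail_int f \<longlongrightarrow> 0) at_top"
proof -
  have "((\<lambda>b. LINT x:{a..b}|lborel. f x) \<longlongrightarrow> tail_int f a) at_top"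
    unfolding tail_int_def by (rule tendsto_set_lebesgue_integral_at_top[OF _ int]) auto
  moreover have "\<forall>\<^sub>F b in at_top. (LINT x:{a..b}|lborel. f x) = integral {a..b} f"
    by (intro always_eventually allI set_borel_integral_eq_integral(2)
        set_integrable_subset[OF int]) auto
  ultimately have "((\<lambda>b. integral {a..b} f) \<longlongrightarrow> tail_int f a) at_top"
    by (rule Lim_transform_eventually)
  from tendsto_diff[OF tendsto_const this, of "tail_int f a"]
  have "((\<lambda>b. tail_int f a - integral {a..b} f) \<longlongrightarrow> 0) at_top" by simp
  moreover have "\<forall>\<^sub>F b in at_top. tail_int f a - integral {a..b} f = tail_int f b"
    using eventually_ge_at_top[of a]
    by eventually_elim (rule tail_int_eq_diff[OF cont int, symmetric])
  ultimately show ?thesis by (rule Lim_transform_eventually)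
qed

lemma tail_int_has_real_derivative:
  assumes cont: "continuous_on {a..} f" and int: "set_integrable lborel {a..} f" and z: "a < z"
  shows "(tail_int f has_real_derivative - f z) (at z)"
proof -
  have "((\<lambda>x. integral {a..x} f) has_real_derivative f z) (at z within {a..z+1})"
    using z by (intro integral_has_real_derivative continuous_on_subset[OF cont]) auto
  hence "((\<lambda>x. tail_int f a - integral {a..x} f) has_real_derivative - f z) (at z)"
    using z by (auto intro!: derivative_eq_intros simp: at_within_Icc_at)
  moreover have "\<forall>\<^sub>F x in nhds z. x \<in> {a<..}"
    using z by (intro eventually_nhds_in_open) auto
  hence "\<forall>\<^sub>F x in nhds z. tail_int f a - integral {a..x} f = tail_int f x"
    by eventually_elim (auto intro: tail_int_eq_diff[OF cont int, symmetric])
  ultimately show ?thesis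
    by (rule DERIV_cong_ev[THEN iffD1, OF refl _ refl, rotated])
qed

text \<open>By (H2), q enters this regime beyond some point, for every e > 0.\<close>

locale slow_growth =
  fixes q q' :: "real \<Rightarrow> real" and a e :: real
  assumes e_pos: "0 < e"
    and deriv: "\<And>x. a \<le> x \<Longrightarrow> (q has_real_derivative q' x) (at x)"
    and one_le: "\<And>x. a \<le> x \<Longrightarrow> 1 \<le> q x"
    and deriv_div_sq_le: "\<And>x. a \<le> x \<Longrightarrow> q' x / (q x)\<^sup>2 \<le> e"
begin

lemma q_pos: "a \<le> x \<Longrightarrow> 0 < q x"
  using one_le[of x] by simp

lemma continuous_on_q: "continuous_on {a..} q"
proof (intro continuous_at_imp_continuous_on ballI)
  fix x assume "x \<in> {a..}"
  hence "a \<le> x" by simp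
  from deriv[OF this] show "isCont q x" by (rule DERIV_isCont)
qed

lemma continuous_on_inverse_power: "continuous_on {a..} (\<lambda>x. 1 / q x ^ n)"
proof (intro continuous_on_divide continuous_on_const continuous_on_power continuous_on_q ballI)
  fix x assume "x \<in> {a..}"
  hence "0 < q x" by (intro q_pos) simp
  thus "q x ^ n \<noteq> 0" by (intro power_not_zero) simp
qed

lemma q_le_double:
  assumes y: "a \<le> y" and t: "y \<le> t" "t \<le> y + 1 / (2 * e * q y)"
  shows "q t \<le> 2 * q y"
proof -
  have "inverse (q y) + e * y \<le> inverse (q t) + e * t"
  proof (rule DERIV_nonneg_imp_nondecreasing[OF t(1)])
    fix x assume "y \<le> x" "x \<le> t"
    with y have x: "a \<le> x" by simp
    have "((\<lambda>x. inverse (q x)) has_real_derivative - (q' x * inverse (q x ^ 2))) (at x)"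
      using DERIV_inverse_fun[OF deriv[OF x]] q_pos[OF x] by (simp add: numeral_2_eq_2)
    hence "((\<lambda>x. inverse (q x) + e * x) has_real_derivative - (q' x * inverse (q x ^ 2)) + e) (at x)"
      by (intro DERIV_add DERIV_cmult_Id)
    moreover have "0 \<le> - (q' x * inverse (q x ^ 2)) + e"
      using deriv_div_sq_le[OF x] by (simp add: divide_inverse)
    ultimately show "\<exists>d. ((\<lambda>x. inverse (q x) + e * x) has_real_derivative d) (at x) \<and> 0 \<le> d"
      by (intro exI conjI)
  qed
  moreover have "e * (t - y) \<le> inverse (2 * q y)"
    using mult_left_mono[of "t - y" "1 / (2 * e * q y)" e] t e_pos by (simp add: inverse_eq_divide)
  ultimately have "inverse (2 * q y) \<le> inverse (q t)" by (simp add: algebra_simps)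
  thus ?thesis by (rule inverse_le_imp_le) (use q_pos[OF y] in simp)
qed

lemma integral_inverse_power_lower:
  assumes z: "a \<le> z" and int: "(\<lambda>x. 1 / q x ^ n) integrable_on {z..}"
  shows "1 / ((2 * q z) ^ n * (2 * e * q z)) \<le> integral {z..} (\<lambda>x. 1 / q x ^ n)"
proof -
  define h where "h = 1 / (2 * e * q z)"
  have qz: "1 \<le> q z" using one_le[OF z] .
  have h: "0 \<le> h" using qz e_pos by (simp add: h_def)
  have int_h: "(\<lambda>x. 1 / q x ^ n) integrable_on {z..z+h}"
    using z by (intro integrable_continuous_interval continuous_on_subset[OF continuous_on_inverse_power]) auto
  have "1 / (2 * q z) ^ n \<le> 1 / q x ^ n" if "z \<le> x" "x \<le> z + h" for x
  proof -
    have "q x \<le> 2 * q z" using q_le_double[OF z that[unfolded h_def]] .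
    with one_le[of x] z that show ?thesis
      by (intro divide_left_mono power_mono mult_pos_pos) auto
  qed
  hence "integral {z..z+h} (\<lambda>_. 1 / (2 * q z) ^ n) \<le> integral {z..z+h} (\<lambda>x. 1 / q x ^ n)"
    by (intro integral_le[OF integrable_const_ivl int_h]) auto
  also have "\<dots> \<le> integral {z..} (\<lambda>x. 1 / q x ^ n)"
    using z by (intro integral_subset_le[OF _ int_h int]) (auto intro!: zero_le_power less_imp_le[OF q_pos])
  finally show ?thesis using h by (simp add: h_def mult.commute)
qed

lemma nn_integral_exp_neg_gam_lower:
  assumes a: "0 \<le> a" and cont: "continuous_on {0..} q" and y: "a \<le> y"
  shows "ennreal (exp (- gam q y - 2 / e) / (2 * e * q y))
           \<le> (\<integral>\<^sup>+ \<xi>\<in>{y..}. ennreal (exp (- gam q \<xi>)) \<partial>lborel)"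
proof -
  define h where "h = 1 / (2 * e * q y)"
  have qy: "1 \<le> q y" using one_le[OF y] .
  have h: "0 \<le> h" using qy e_pos by (simp add: h_def)
  have exp_le: "exp (- gam q y - 2 / e) \<le> exp (- gam q t)" if t: "y \<le> t" "t \<le> y + h" for t
  proof -
    have int: "q integrable_on {0..t}"
      using a y t by (intro integrable_continuous_interval continuous_on_subset[OF cont]) auto
    have "q s \<le> 2 * q y" if "s \<in> {y..t}" for s
      using that t by (intro q_le_double[OF y]) (auto simp: h_def)
    hence "integral {y..t} q \<le> integral {y..t} (\<lambda>_. 2 * q y)"
      using a y by (intro integral_le integrable_on_subinterval[OF int] integrable_const_ivl) auto
    also have "\<dots> \<le> h * (2 * q y)"
      using t qy by (simp add: mult_right_mono)
    also have "\<dots> = 1 / e" using qy e_pos by (simp add: h_def)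
    finally have "integral {y..t} q \<le> 1 / e" .
    moreover have "gam q t = gam q y + integral {y..t} q + integral {y..t} q"
      using Henstock_Kurzweil_Integration.integral_combine[of 0 y t q] a y t int
      unfolding gam_def by simp
    ultimately show ?thesis by simp
  qed
  have "ennreal (exp (- gam q y - 2 / e) / (2 * e * q y)) = ennreal (exp (- gam q y - 2 / e)) * ennreal h"
    using h by (simp add: h_def ennreal_mult'' [symmetric])
  also have "\<dots> = (\<integral>\<^sup>+ \<xi>. ennreal (exp (- gam q y - 2 / e)) * indicator {y..y+h} \<xi> \<partial>lborel)"
    using h by (simp add: nn_integral_cmult_indicator)
  also have "\<dots> \<le> (\<integral>\<^sup>+ \<xi>\<in>{y..}. ennreal (exp (- gam q \<xi>)) \<partial>lborel)"
  proof (rule nn_integral_mono)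
    fix \<xi>
    show "ennreal (exp (- gam q y - 2 / e)) * indicator {y..y+h} \<xi>
        \<le> ennreal (exp (- gam q \<xi>)) * indicator {y..} \<xi>"
      using exp_le[of \<xi>] by (cases "\<xi> \<in> {y..y+h}") (simp_all add: ennreal_leI)
  qed
  finally show ?thesis .
qed


lemma set_integrable_inverse_of_H1:
  assumes a: "0 \<le> a" and cont: "continuous_on {0..} q"
    and H1: "(\<integral>\<^sup>+ y\<in>{0..}. ennreal (exp (gam q y)) *
               (\<integral>\<^sup>+ \<xi>\<in>{y..}. ennreal (exp (- gam q \<xi>)) \<partial>lborel) \<partial>lborel) < \<infinity>"
  shows "set_integrable lborel {a..} (\<lambda>x. 1 / q x)"
proof -
  define c where "c = exp (- 2 / e) / (2 * e)"
  have c: "0 < c" using e_pos by (simp add: c_def)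
  have "(\<integral>\<^sup>+ x\<in>{a..}. ennreal (c * (1 / q x)) \<partial>lborel)
      \<le> (\<integral>\<^sup>+ y\<in>{0..}. ennreal (exp (gam q y)) *
               (\<integral>\<^sup>+ \<xi>\<in>{y..}. ennreal (exp (- gam q \<xi>)) \<partial>lborel) \<partial>lborel)"
  proof (rule nn_integral_mono)
    fix y
    show "ennreal (c * (1 / q y)) * indicator {a..} y
      \<le> ennreal (exp (gam q y)) * (\<integral>\<^sup>+ \<xi>\<in>{y..}. ennreal (exp (- gam q \<xi>)) \<partial>lborel) * indicator {0..} y"
    proof (cases "a \<le> y")
      case True
      have "c * (1 / q y) = exp (gam q y) * (exp (- gam q y - 2 / e) / (2 * e * q y))"
        by (simp add: c_def exp_diff exp_minus field_simps)
      hence "ennreal (c * (1 / q y)) = ennreal (exp (gam q y)) * ennreal (exp (- gam q y - 2 / e) / (2 * e * q y))"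
        by (simp only: ennreal_mult'[OF exp_ge_zero])
      also have "\<dots> \<le> ennreal (exp (gam q y)) * (\<integral>\<^sup>+ \<xi>\<in>{y..}. ennreal (exp (- gam q \<xi>)) \<partial>lborel)"
        by (rule mult_left_mono[OF nn_integral_exp_neg_gam_lower[OF a cont True]]) simp
      finally show ?thesis using True a by simp
    qed simp
  qed
  hence "(\<integral>\<^sup>+ x\<in>{a..}. ennreal (c * (1 / q x)) \<partial>lborel) < \<infinity>"
    using H1 by (rule le_less_trans)
  hence "set_integrable lborel {a..} (\<lambda>x. c * (1 / q x))"
    using c q_pos
    by (intro set_integrable_of_nn_integral_finite continuous_intros continuous_on_inverse_power[of 1, simplified])
       (auto intro: less_imp_le)
  thus ?thesis using c by (subst (asm) set_integrable_mult_right_iff) auto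
qed

lemma set_integrable_inverse_power:
  assumes int: "set_integrable lborel {a..} (\<lambda>x. 1 / q x)" and n: "0 < n"
  shows "set_integrable lborel {a..} (\<lambda>x. 1 / q x ^ n)"
proof (rule set_integrable_bound[OF int])
  show "set_borel_measurable lborel {a..} (\<lambda>x. 1 / q x ^ n)"
    unfolding set_borel_measurable_def
    using borel_measurable_continuous_on_indicator[OF _ continuous_on_inverse_power] by simp
  have "norm (1 / q x ^ n) \<le> norm (1 / q x)" if x: "a \<le> x" for x
  proof -
    have "q x \<le> q x ^ n" using self_le_power[OF one_le[OF x] n] .
    thus ?thesis using q_pos[OF x] by (auto intro!: divide_left_mono)
  qed
  thus "AE x in lborel. x \<in> {a..} \<longrightarrow> norm (1 / q x ^ n) \<le> norm (1 / q x)"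
    by auto
qed

lemma tail_int_inverse_power_pos:
  assumes int: "set_integrable lborel {a..} (\<lambda>x. 1 / q x ^ n)" and z: "a \<le> z"
  shows "0 < tail_int (\<lambda>x. 1 / q x ^ n) z"
proof -
  have "0 < 1 / ((2 * q z) ^ n * (2 * e * q z))"
    using q_pos[OF z] e_pos by simp
  also have "\<dots> \<le> tail_int (\<lambda>x. 1 / q x ^ n) z"
    using integral_inverse_power_lower[OF z tail_int_eq_integral(1)[OF int z]]
    by (simp add: tail_int_eq_integral(2)[OF int z])
  finally show ?thesis .
qed

lemma tail_int_inverse_power_has_real_derivative:
  assumes "set_integrable lborel {a..} (\<lambda>x. 1 / q x ^ n)" and "a < z"
  shows "(tail_int (\<lambda>x. 1 / q x ^ n) has_real_derivative - (1 / q z ^ n)) (at z)"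
  by (rule tail_int_has_real_derivative[OF continuous_on_inverse_power assms])

end

lemma eventually_has_real_derivative_at:
  fixes f f' :: "real \<Rightarrow> real"
  assumes "\<And>x. c \<le> x \<Longrightarrow> (f has_real_derivative f' x) (at x within {c..})"
  shows "\<forall>\<^sub>F x in at_top. (f has_real_derivative f' x) (at x)"
  using eventually_gt_at_top[of c]
proof eventually_elim
  case (elim x)
  hence "at x within {c..} = at x" by (intro at_within_interior) simp
  with assms[of x] elim show ?case by simp
qed

lemma eventually_slow_growth:
  fixes q q' :: "real \<Rightarrow> real"
  assumes q_top: "filterlim q at_top at_top"
    and ratio: "((\<lambda>x. q' x / (q x)\<^sup>2) \<longlongrightarrow> 0) at_top"
    and deriv: "\<forall>\<^sub>F x in at_top. (q has_real_derivative q' x) (at x)"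
    and e: "0 < e"
  shows "\<forall>\<^sub>F a in at_top. slow_growth q q' a e"
proof -
  have "\<forall>\<^sub>F x in at_top. (q has_real_derivative q' x) (at x) \<and> 1 \<le> q x \<and> q' x / (q x)\<^sup>2 \<le> e"
    using deriv filterlim_at_top[THEN iffD1, OF q_top, rule_format, of 1] order_tendstoD(2)[OF ratio e]
    by eventually_elim simp
  from eventually_all_ge_at_top[OF this] show ?thesis
    by eventually_elim (simp add: slow_growth_def e)
qed

lemma filterlim_sq_mult_tail_int_at_top:
  fixes q q' :: "real \<Rightarrow> real"
  assumes q_top: "filterlim q at_top at_top"
    and ratio: "((\<lambda>x. q' x / (q x)\<^sup>2) \<longlongrightarrow> 0) at_top"
    and deriv: "\<forall>\<^sub>F x in at_top. (q has_real_derivative q' x) (at x)"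
    and int: "set_integrable lborel {c..} (\<lambda>x. 1 / q x)"
  shows "filterlim (\<lambda>z. (q z)\<^sup>2 * tail_int (\<lambda>x. 1 / q x) z) at_top at_top"
  unfolding filterlim_at_top_gt[where c = 0]
proof (intro allI impI)
  fix Z :: real assume Z: "0 < Z"
  hence e: "0 < 1 / (4 * Z)" by simp
  show "\<forall>\<^sub>F z in at_top. Z \<le> (q z)\<^sup>2 * tail_int (\<lambda>x. 1 / q x) z"
    using eventually_slow_growth[OF q_top ratio deriv e] eventually_ge_at_top[of c]
  proof eventually_elim
    case (elim z)
    then interpret slow_growth q q' z "1 / (4 * Z)" by simp
    have "Z / (q z)\<^sup>2 \<le> tail_int (\<lambda>x. 1 / q x) z"
      using integral_inverse_power_lower[of z 1] tail_int_eq_integral[OF int] elim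
      by (simp add: power2_eq_square)
    thus ?case using q_pos[of z] by (simp add: field_simps)
  qed
qed

lemma frequently_deriv_nonneg_of_filterlim_at_top:
  fixes q q' :: "real \<Rightarrow> real"
  assumes q_top: "filterlim q at_top at_top"
    and deriv: "\<forall>\<^sub>F x in at_top. (q has_real_derivative q' x) (at x)"
  shows "\<exists>\<^sub>F x in at_top. 0 \<le> q' x"
  unfolding frequently_def
proof
  assume "\<forall>\<^sub>F x in at_top. \<not> 0 \<le> q' x"
  with deriv have "\<forall>\<^sub>F x in at_top. (q has_real_derivative q' x) (at x) \<and> q' x < 0"
    by eventually_elim simp
  then obtain N where N: "\<And>x. N \<le> x \<Longrightarrow> (q has_real_derivative q' x) (at x) \<and> q' x < 0"
    by (auto simp: eventually_at_top_linorder)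
  have decr: "q x \<le> q N" if "N \<le> x" for x
    using N by (intro DERIV_nonpos_imp_nonincreasing[OF that]) (auto intro: less_imp_le)
  obtain M where "\<And>x. M \<le> x \<Longrightarrow> q N + 1 \<le> q x"
    using filterlim_at_top[THEN iffD1, OF q_top, rule_format, of "q N + 1"]
    by (auto simp: eventually_at_top_linorder)
  hence "q N + 1 \<le> q (max M N)" by simp
  with decr[of "max M N"] show False by (simp add: max_def split: if_splits)
qed

lemma tendsto_deriv_mult_pos_nonneg:
  fixes q q' g :: "real \<Rightarrow> real"
  assumes q_top: "filterlim q at_top at_top"
    and deriv: "\<forall>\<^sub>F x in at_top. (q has_real_derivative q' x) (at x)"
    and g_pos: "\<forall>\<^sub>F x in at_top. 0 < g x"
    and lim: "((\<lambda>x. q' x * g x) \<longlongrightarrow> b) at_top"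
  shows "0 \<le> b"
proof (rule ccontr)
  assume "\<not> 0 \<le> b"
  hence "\<forall>\<^sub>F x in at_top. q' x * g x < 0" by (intro order_tendstoD(2)[OF lim]) simp
  with g_pos have "\<forall>\<^sub>F x in at_top. \<not> 0 \<le> q' x"
    by eventually_elim (simp add: mult_less_0_iff)
  with frequently_deriv_nonneg_of_filterlim_at_top[OF q_top deriv] show False
    by (simp add: frequently_def)
qed

lemma tendsto_deriv_div_mult_sqrt:
  fixes q q' F :: "real \<Rightarrow> real"
  assumes lim: "((\<lambda>z. q' z * F z) \<longlongrightarrow> b) at_top"
    and top: "filterlim (\<lambda>z. (q z)\<^sup>2 * F z) at_top at_top"
    and q_pos: "\<forall>\<^sub>F z in at_top. 0 < q z"
  shows "((\<lambda>z. q' z / q z * sqrt (F z)) \<longlongrightarrow> 0) at_top"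
proof -
  have "((\<lambda>z. q' z * F z * inverse (sqrt ((q z)\<^sup>2 * F z))) \<longlongrightarrow> b * 0) at_top"
    by (intro tendsto_mult lim tendsto_inverse_0_at_top filterlim_compose[OF sqrt_at_top top])
  moreover have "\<forall>\<^sub>F z in at_top. q' z * F z * inverse (sqrt ((q z)\<^sup>2 * F z)) = q' z / q z * sqrt (F z)"
    using q_pos filterlim_at_top_dense[THEN iffD1, OF top, rule_format, of 0]
  proof eventually_elim
    case (elim z)
    hence F: "0 < F z" by (simp add: zero_less_mult_iff)
    have "F z = sqrt (F z) * sqrt (F z)" using F by simp
    thus ?case using elim F by (simp add: real_sqrt_mult field_simps)
  qed
  ultimately show ?thesis by (simp add: Lim_transform_eventually)
qed

lemma tendsto_tail_ratio:
  fixes q q' F G :: "real \<Rightarrow> real"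
  assumes q_top: "filterlim q at_top at_top"
    and F0: "(F \<longlongrightarrow> 0) at_top" and G0: "(G \<longlongrightarrow> 0) at_top"
    and G_nz: "\<forall>\<^sub>F z in at_top. G z \<noteq> 0"
    and derivs: "\<forall>\<^sub>F z in at_top. (q has_real_derivative q' z) (at z)
       \<and> (F has_real_derivative - (1 / q z)) (at z) \<and> (G has_real_derivative - (1 / q z ^ 3)) (at z)"
    and lim: "((\<lambda>z. q' z * F z) \<longlongrightarrow> b) at_top"
  shows "((\<lambda>z. F z / ((q z)\<^sup>2 * G z)) \<longlongrightarrow> 2 * b + 1) at_top"
proof -
  have q_pos: "\<forall>\<^sub>F z in at_top. 0 < q z"
    using filterlim_at_top_dense[THEN iffD1, OF q_top] by blast
  have "((\<lambda>z. F z / (q z)\<^sup>2 / G z) \<longlongrightarrow> 2 * b + 1) at_top"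
  proof (rule lhopital_at_top_0[where f' = "\<lambda>z. - (1 + 2 * (q' z * F z)) / q z ^ 3"
                                  and g' = "\<lambda>z. - (1 / q z ^ 3)"])
    show "((\<lambda>z. F z / (q z)\<^sup>2) \<longlongrightarrow> 0) at_top"
      by (intro tendsto_divide_0[OF F0] filterlim_at_top_imp_at_infinity
          filterlim_pow_at_top[OF _ q_top]) simp
    show "\<forall>\<^sub>F z in at_top. ((\<lambda>z. F z / (q z)\<^sup>2) has_real_derivative - (1 + 2 * (q' z * F z)) / q z ^ 3) (at z)"
      using derivs q_pos
      by eventually_elim (auto intro!: derivative_eq_intros simp: field_simps power2_eq_square power3_eq_cube)
    have "((\<lambda>z. 1 + 2 * (q' z * F z)) \<longlongrightarrow> 2 * b + 1) at_top"
      using tendsto_add[OF tendsto_const tendsto_mult[OF tendsto_const lim], of 1 2] by (simp add: add.commute)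
    moreover have "\<forall>\<^sub>F z in at_top. 1 + 2 * (q' z * F z) = (- (1 + 2 * (q' z * F z)) / q z ^ 3) / (- (1 / q z ^ 3))"
      using q_pos by eventually_elim simp
    ultimately show "((\<lambda>z. (- (1 + 2 * (q' z * F z)) / q z ^ 3) / (- (1 / q z ^ 3))) \<longlongrightarrow> 2 * b + 1) at_top"
      by (rule Lim_transform_eventually)
  qed (use G0 G_nz q_pos derivs in \<open>auto elim: eventually_mono\<close>)
  thus ?thesis by (simp add: divide_divide_eq_left)
qed

context slow_growth
begin

lemma eventually_deriv: "\<forall>\<^sub>F x in at_top. (q has_real_derivative q' x) (at x)"
  using eventually_ge_at_top[of a] by eventually_elim (rule deriv)

lemma tail_int_inverse_limits:
  assumes int1: "set_integrable lborel {a..} (\<lambda>x. 1 / q x)"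
    and q_top: "filterlim q at_top at_top"
    and ratio: "((\<lambda>x. q' x / (q x)\<^sup>2) \<longlongrightarrow> 0) at_top"
    and lim: "((\<lambda>z. q' z * tail_int (\<lambda>x. 1 / q x) z) \<longlongrightarrow> b) at_top"
  shows "b \<ge> 0
    \<and> ((\<lambda>z. q' z / q z * sqrt (tail_int (\<lambda>x. 1 / q x) z)) \<longlongrightarrow> 0) at_top
    \<and> ((\<lambda>z. tail_int (\<lambda>x. 1 / q x) z / ((q z)\<^sup>2 * tail_int (\<lambda>x. 1 / q x ^ 3) z))
         \<longlongrightarrow> 2 * b + 1) at_top"
proof -
  define F where "F = tail_int (\<lambda>x. 1 / q x)"
  define G where "G = tail_int (\<lambda>x. 1 / q x ^ 3)"
  have int3: "set_integrable lborel {a..} (\<lambda>x. 1 / q x ^ 3)"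
    by (rule set_integrable_inverse_power[OF int1]) simp
  note F_deriv = tail_int_inverse_power_has_real_derivative[where n = 1, simplified, OF int1]
  note F_pos = tail_int_inverse_power_pos[where n = 1, simplified, OF int1]
  have derivs: "\<forall>\<^sub>F z in at_top. (q has_real_derivative q' z) (at z)
       \<and> (F has_real_derivative - (1 / q z)) (at z) \<and> (G has_real_derivative - (1 / q z ^ 3)) (at z)"
    using eventually_gt_at_top[of a] unfolding F_def G_def
    by eventually_elim (simp add: deriv F_deriv tail_int_inverse_power_has_real_derivative[OF int3])
  have pos: "\<forall>\<^sub>F z in at_top. 0 < q z \<and> 0 < F z \<and> G z \<noteq> 0"
    using eventually_ge_at_top[of a] unfolding F_def G_def
  proof eventually_elim
    case (elim z)
    thus ?case using q_pos F_pos tail_int_inverse_power_pos[OF int3, of z] by simp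
  qed
  note lim = lim[folded F_def]
  have "0 \<le> b"
    by (intro tendsto_deriv_mult_pos_nonneg[OF q_top eventually_deriv _ lim]
        eventually_mono[OF pos]) simp
  moreover have "((\<lambda>z. q' z / q z * sqrt (F z)) \<longlongrightarrow> 0) at_top"
    by (intro tendsto_deriv_div_mult_sqrt[OF lim] eventually_mono[OF pos]
        filterlim_sq_mult_tail_int_at_top[OF q_top ratio eventually_deriv int1, folded F_def]) simp
  moreover have "((\<lambda>z. F z / ((q z)\<^sup>2 * G z)) \<longlongrightarrow> 2 * b + 1) at_top"
    by (intro tendsto_tail_ratio[OF q_top _ _ _ derivs lim] eventually_mono[OF pos]
        tendsto_tail_int_at_top[OF continuous_on_inverse_power[where n = 1, simplified] int1, folded F_def]
        tendsto_tail_int_at_top[OF continuous_on_inverse_power int3, folded G_def]) simp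
  ultimately show ?thesis by (simp add: F_def G_def)
qed

end

theorem mainTheorem14:
  fixes q q' :: "real \<Rightarrow> real" and b :: real
  assumes deriv: "\<And>x. x \<ge> 0 \<Longrightarrow> (q has_real_derivative q' x) (at x within {0..})"
    and cont: "continuous_on {0..} q'"
    and H1: "(\<integral>\<^sup>+ y\<in>{0..}. ennreal (exp (gam q y)) *
               (\<integral>\<^sup>+ \<xi>\<in>{y..}. ennreal (exp (- gam q \<xi>)) \<partial>lborel) \<partial>lborel) < \<infinity>"
    and H2a: "filterlim q at_top at_top"
    and H2b: "((\<lambda>x. q' x / (q x)\<^sup>2) \<longlongrightarrow> 0) at_top"
    and lim: "((\<lambda>z. q' z * tail_int (\<lambda>x. 1 / q x) z) \<longlongrightarrow> b) at_top"
  shows "b \<ge> 0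
    \<and> ((\<lambda>z. q' z / q z * sqrt (tail_int (\<lambda>x. 1 / q x) z)) \<longlongrightarrow> 0) at_top
    \<and> ((\<lambda>z. tail_int (\<lambda>x. 1 / q x) z / ((q z)\<^sup>2 * tail_int (\<lambda>x. 1 / (q x) ^ 3) z))
         \<longlongrightarrow> 2 * b + 1) at_top"
proof -
  have cont_q: "continuous_on {0..} q"
    using deriv by (intro DERIV_continuous_on[where D = q']) auto
  have deriv_at: "\<forall>\<^sub>F x in at_top. (q has_real_derivative q' x) (at x)"
    by (rule eventually_has_real_derivative_at[OF deriv])
  have "\<forall>\<^sub>F a in at_top. 0 \<le> a \<and> slow_growth q q' a 1"
    using eventually_ge_at_top[of 0] eventually_slow_growth[OF H2a H2b deriv_at zero_less_one]
    by eventually_elim simp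
  then obtain a where a: "0 \<le> a" and "slow_growth q q' a 1"
    using eventually_happens'[OF trivial_limit_at_top_linorder] by blast
  then interpret slow_growth q q' a 1 by simp
  show ?thesis
    using tail_int_inverse_limits[OF set_integrable_inverse_of_H1[OF a cont_q H1] H2a H2b lim] .
qed

end
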